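(* Let $n\geqslant 2$ and let $E\subset\mathbb{R}^n$ be an open weakly $1$-semiconvex set whose $1$-nonsemiconvexity-point set $E^{\diamondsuit}$ is non-empty. Then there exists a collection of rays $\{\eta(x)\}_{x\in\partial E^{\diamondsuit}}$, where $\eta(x)$ is a ray emanating from $x$, such that: (i) the set $\bigcup_{x\in\partial E^{\diamondsuit}}\eta(x)\cup E^{\diamondsuit}$ does not contain any ray emanating from a point of $E^{\diamondsuit}$; and (ii) $\left(\bigcup_{x\in\partial E^{\diamondsuit}}\eta(x)\right)\cap E=\varnothing$.
   Context: $\mathbb{R}^n$ carries the Euclidean norm. A ray is a closed half-line $\{y+t\alpha: t\in[0,+\infty)\}$ with $y\in\mathbb{R}^n$ and $\|\alpha\|=1$; it emanates from $y$. An open set $E\subset\mathbb{R}^n$ is called weakly $1$-semiconvex if for every point $x\in\partial E$ there exists a ray $L$ with $x\in L$ and $L\cap E=\varnothing$ (equivalently, a ray emanating from $x$ with this property). A point $x\in\mathbb{R}^n\setminus E$ is a $1$-nonsemiconvexity point of $E\subset\mathbb{R}^n$ if every ray emanating from $x$ intersects $E$. $E^{\diamondsuit}$ denotes the set of all $1$-nonsemiconvexity points of $E$. *)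

theory Defs
  imports "HOL-Analysis.Analysis"
begin

definition emanates_from :: "(real ^ 'n) set \<Rightarrow> real ^ 'n \<Rightarrow> bool" where
  "emanates_from L y \<longleftrightarrow> (\<exists>\<alpha>. norm \<alpha> = 1 \<and> L = {y + t *\<^sub>R \<alpha> | t. 0 \<le> t})"

definition is_ray :: "(real ^ 'n) set \<Rightarrow> bool" where
  "is_ray L \<longleftrightarrow> (\<exists>y. emanates_from L y)"

text \<open>The notion is only meant for open sets; openness is assumed separately.\<close>

definition weakly_1_semiconvex :: "(real ^ 'n) set \<Rightarrow> bool" where
  "weakly_1_semiconvex E \<longleftrightarrow> (\<forall>x \<in> frontier E. \<exists>L. is_ray L \<and> x \<in> L \<and> L \<inter> E = {})"

definition nonsemiconvexity_points :: "(real ^ 'n) set \<Rightarrow> (real ^ 'n) set" where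
  "nonsemiconvexity_points E = {x. x \<notin> E \<and> (\<forall>L. emanates_from L x \<longrightarrow> L \<inter> E \<noteq> {})}"

end

(* Since E is weakly semiconvex, no nonsemiconvexity point lies on the frontier of E; compactness
   of the unit sphere then makes the set of nonsemiconvexity points open. Hence a frontier point of
   it is neither a nonsemiconvexity point nor, E being open and disjoint from it, a point of E, so
   some ray from it misses E. Any choice of such rays works: a ray from a nonsemiconvexity point
   meets E, whereas the union in (i) is disjoint from E. *)
theory Submission
  imports Defs
begin

lemma nonsemiconvexity_points_disjoint: "nonsemiconvexity_points E \<inter> E = {}"
  by (auto simp: nonsemiconvexity_points_def)

text \<open>The tail of \<open>L\<close> starting at \<open>x\<close> is such a ray. This links weak
  semiconvexity, which allows \<open>x\<close> anywhere on the ray, to nonsemiconvexity points,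
  which concern only rays starting at \<open>x\<close>.\<close>

lemma is_ray_contains_subray:
  assumes "is_ray L" "x \<in> L"
  obtains M where "emanates_from M x" "M \<subseteq> L"
proof -
  obtain y \<alpha> where \<alpha>: "norm \<alpha> = 1" and L: "L = {y + t *\<^sub>R \<alpha> | t. 0 \<le> t}"
    using assms(1) by (auto simp: is_ray_def emanates_from_def)
  obtain s where s: "0 \<le> s" "x = y + s *\<^sub>R \<alpha>"
    using assms(2) L by auto
  have "x + t *\<^sub>R \<alpha> = y + (s + t) *\<^sub>R \<alpha>" for t
    by (simp add: s(2) scaleR_add_left)
  hence "{x + t *\<^sub>R \<alpha> | t. 0 \<le> t} \<subseteq> L"
    using s(1) L by (smt (verit) mem_Collect_eq subsetI)
  with \<alpha> that show ?thesis
    by (auto simp: emanates_from_def)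
qed

text \<open>Projecting a closed set of pairs (direction, base point) along the compact unit sphere
  of directions preserves closedness.\<close>

lemma closed_ray_avoiding:
  assumes "open E"
  shows "closed {x. \<exists>L. emanates_from L x \<and> L \<inter> E = {}}"
proof -
  \<comment> \<open>For each fixed \<open>t\<close> the condition is the preimage of the closed set
    \<open>- E\<close> under a continuous map, so the intersection is closed. The direction is the
    first component, the one to be projected away.\<close>
  define T where "T = (\<Inter>t\<in>{0..}. {p. snd p + t *\<^sub>R fst p \<in> - E})"
  have "closed T"
    unfolding T_def using assms
    by (intro closed_INT ballI closed_vimage[unfolded vimage_def]) (auto intro!: continuous_intros)
  hence "closed {x. \<exists>\<alpha>. \<alpha> \<in> sphere 0 1 \<and> (\<alpha>, x) \<in> T}"
    by (intro closed_compact_projection) auto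
  also have "{x. \<exists>\<alpha>. \<alpha> \<in> sphere 0 1 \<and> (\<alpha>, x) \<in> T} = {x. \<exists>L. emanates_from L x \<and> L \<inter> E = {}}"
  proof -
    have "(\<alpha>, x) \<in> T \<longleftrightarrow> {x + t *\<^sub>R \<alpha> | t. 0 \<le> t} \<inter> E = {}" for \<alpha> x
      by (auto simp: T_def)
    thus ?thesis
      unfolding emanates_from_def by auto
  qed
  finally show ?thesis .
qed

lemma open_nonsemiconvexity_points:
  assumes "open E" "weakly_1_semiconvex E"
  shows "open (nonsemiconvexity_points E)"
proof -
  have "x \<notin> nonsemiconvexity_points E" if x: "x \<in> frontier E" for x
  proof -
    obtain L where L: "is_ray L" "x \<in> L" "L \<inter> E = {}"
      using assms(2) x by (auto simp: weakly_1_semiconvex_def)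
    from L(1,2) obtain M where "emanates_from M x" "M \<subseteq> L"
      by (rule is_ray_contains_subray)
    moreover have "M \<inter> E = {}"
      using \<open>M \<subseteq> L\<close> L(3) by blast
    ultimately show ?thesis
      by (auto simp: nonsemiconvexity_points_def)
  qed
  \<comment> \<open>The definition only gives \<open>- E\<close> as the first factor; with frontier
    points of \<open>E\<close> excluded it shrinks to the open set
    \<open>- closure E\<close>.\<close>
  hence "nonsemiconvexity_points E
      = - closure E \<inter> - {x. \<exists>L. emanates_from L x \<and> L \<inter> E = {}}"
    unfolding closure_Un_frontier nonsemiconvexity_points_def by blast
  thus ?thesis
    using closed_ray_avoiding[OF assms(1)] by (auto intro!: open_Int)
qed

theorem proposition1:
  fixes E :: "(real ^ 'n) set"
  assumes "CARD('n) \<ge> 2"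
    and "open E"
    and "weakly_1_semiconvex E"
    and "nonsemiconvexity_points E \<noteq> {}"
  shows "\<exists>\<eta> :: real ^ 'n \<Rightarrow> (real ^ 'n) set.
    (\<forall>x \<in> frontier (nonsemiconvexity_points E). emanates_from (\<eta> x) x) \<and>
    \<not> (\<exists>y \<in> nonsemiconvexity_points E. \<exists>L. emanates_from L y \<and>
        L \<subseteq> (\<Union>x \<in> frontier (nonsemiconvexity_points E). \<eta> x) \<union> nonsemiconvexity_points E) \<and>
    (\<Union>x \<in> frontier (nonsemiconvexity_points E). \<eta> x) \<inter> E = {}"
proof -
  let ?N = "nonsemiconvexity_points E"
  have "\<exists>L. emanates_from L x \<and> L \<inter> E = {}" if "x \<in> frontier ?N" for x
  proof -
    have "x \<notin> ?N"
      using that open_nonsemiconvexity_points[OF assms(2,3)]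
      by (simp add: frontier_def interior_open)
    \<comment> \<open>An open set disjoint from \<open>?N\<close> is also disjoint from its closure,
      which contains \<open>x\<close>.\<close>
    moreover have "x \<notin> E"
      using that open_Int_closure_eq_empty[OF assms(2), of ?N] nonsemiconvexity_points_disjoint[of E]
      by (auto simp: frontier_def)
    ultimately show ?thesis
      by (auto simp: nonsemiconvexity_points_def)
  qed
  then obtain \<eta> where \<eta>: "\<And>x. x \<in> frontier ?N \<Longrightarrow> emanates_from (\<eta> x) x \<and> \<eta> x \<inter> E = {}"
    by metis
  hence disj: "(\<Union>x \<in> frontier ?N. \<eta> x) \<inter> E = {}"
    by blast
  have "\<not> L \<subseteq> (\<Union>x \<in> frontier ?N. \<eta> x) \<union> ?N" if "y \<in> ?N" "emanates_from L y" for y L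
  proof -
    have "L \<inter> E \<noteq> {}"
      using that by (auto simp: nonsemiconvexity_points_def)
    with disj nonsemiconvexity_points_disjoint[of E] show ?thesis
      by blast
  qed
  with \<eta> disj show ?thesis
    by blast
qed

end
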